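(* Let $m,n$ be positive integers and let $A=(a_{ij})\in\mathbb{R}^{m\times n}$ be a given matrix. Then there exists a unique polynomial $P\in\mathcal{P}_m^n$ satisfying $a_{ij}=P(i,j)$ for all $i=1,\ldots,m$, $j=1,\ldots,n$, and it is given by $$P(x,y)=p_1(x)+\frac{(y-1)}{1!}\Delta p_1(x)+\frac{(y-1)(y-2)}{2!}\Delta^2p_1(x)+\cdots+\frac{(y-1)(y-2)\cdots(y-(n-1))}{(n-1)!}\Delta^{n-1}p_1(x),$$ where $$\Delta^{r}p_1(x)=\sum_{\beta=0}^{r}(-1)^{\beta}\binom{r}{\beta}p_{r+1-\beta}(x)\quad\text{for all } r=1,2,\ldots,n-1,$$ and, for all $r=1,2,\ldots,n$, $$p_r(x)=a_{1r}+\frac{(x-1)}{1!}\Delta a_{1r}+\frac{(x-1)(x-2)}{2!}\Delta^2a_{1r}+\cdots+\frac{(x-1)(x-2)\cdots(x-(m-1))}{(m-1)!}\Delta^{m-1}a_{1r},$$ where $$\Delta^{k}a_{1r}=\sum_{\alpha=0}^{k}(-1)^{\alpha}\binom{k}{\alpha}a_{(k+1-\alpha)r}\quad\text{for all } k=1,2,\ldots,m-1.$$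
   Context: For positive integers $m,n$, $\mathcal{P}_m^n$ denotes the real vector space of polynomials in two variables $x,y$ of the form $P(x,y)=\sum_{k_1=0}^{m-1}\sum_{k_2=0}^{n-1}\lambda_{k_1,k_2}x^{k_1}y^{k_2}$ with $\lambda_{k_1,k_2}\in\mathbb{R}$. *)

theory Defs
  imports "Jordan_Normal_Form.Matrix" "HOL-Computational_Algebra.Polynomial"
begin

text \<open>
  A polynomial in \<open>x\<close>, \<open>y\<close> is an element of \<open>\<real>[x][y]\<close>: the outer variable is \<open>y\<close>, the
  coefficients are polynomials in \<open>x\<close>, and \<open>monom (monom c k\<^sub>1) k\<^sub>2\<close> is \<open>c x^k\<^sub>1 y^k\<^sub>2\<close>.
\<close>

definition poly_space :: "nat \<Rightarrow> nat \<Rightarrow> real poly poly set" where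
  "poly_space m n =
     {P. \<exists>c :: nat \<Rightarrow> nat \<Rightarrow> real. P = (\<Sum>k\<^sub>1<m. \<Sum>k\<^sub>2<n. monom (monom (c k\<^sub>1 k\<^sub>2) k\<^sub>1) k\<^sub>2)}"

definition eval2 :: "real poly poly \<Rightarrow> real \<Rightarrow> real \<Rightarrow> real" where
  "eval2 P x y = poly (poly P [:y:]) x"

text \<open>The entry \<open>a\<^sub>i\<^sub>j\<close> with indices starting from 1; the library's indices start from 0.\<close>

definition entry :: "real mat \<Rightarrow> nat \<Rightarrow> nat \<Rightarrow> real" where
  "entry A i j = A $$ (i - 1, j - 1)"

definition newton_coeff :: "nat \<Rightarrow> real \<Rightarrow> real" where
  "newton_coeff k x = (\<Prod>s=1..k. x - real s) / fact k"

text \<open>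
  \<open>\<Delta>\<^sup>k a\<^sub>1\<^sub>r\<close>, the \<open>k\<close>-th forward difference down column \<open>r\<close>, taken at row 1. The subtraction
  on naturals never truncates since \<open>\<alpha> \<le> k\<close>; likewise in \<open>delta_p\<close> below.
\<close>

definition delta_a :: "real mat \<Rightarrow> nat \<Rightarrow> nat \<Rightarrow> real" where
  "delta_a A k r = (\<Sum>\<alpha>=0..k. (-1) ^ \<alpha> * real (k choose \<alpha>) * entry A (k + 1 - \<alpha>) r)"

text \<open>\<open>p\<^sub>r(x)\<close>, the Newton interpolant of column \<open>r\<close>, where \<open>m\<close> is the number of rows of \<open>A\<close>.\<close>

definition col_poly :: "real mat \<Rightarrow> nat \<Rightarrow> nat \<Rightarrow> real \<Rightarrow> real" where
  "col_poly A m r x = entry A 1 r + (\<Sum>k=1..m-1. newton_coeff k x * delta_a A k r)"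

text \<open>\<open>\<Delta>\<^sup>r p\<^sub>1(x)\<close>, the \<open>r\<close>-th forward difference of \<open>p\<^sub>1(x), p\<^sub>2(x), \<dots>\<close> in the column index.\<close>

definition delta_p :: "real mat \<Rightarrow> nat \<Rightarrow> nat \<Rightarrow> real \<Rightarrow> real" where
  "delta_p A m r x = (\<Sum>\<beta>=0..r. (-1) ^ \<beta> * real (r choose \<beta>) * col_poly A m (r + 1 - \<beta>) x)"

definition interpolates :: "nat \<Rightarrow> nat \<Rightarrow> real mat \<Rightarrow> real poly poly \<Rightarrow> bool" where
  "interpolates m n A P \<longleftrightarrow>
     (\<forall>i\<in>{1..m}. \<forall>j\<in>{1..n}. entry A i j = eval2 P (real i) (real j))"

end

theory Submission
  imports Defs
begin

text \<open>
  Newton's forward difference formula is applied once in each variable. In one variable, the Newton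
  basis polynomials \<open>newton_coeff k\<close> take the value \<open>j choose k\<close> at \<open>j + 1\<close>, so the Newton form with
  the differences of \<open>f\<close> as coefficients reproduces \<open>f\<close> at the nodes, which is binomial inversion
  (\<open>newton_forward_formula\<close>). In the \<open>y\<close> direction this turns the claimed bivariate formula at
  \<open>y = j\<close> into the column interpolant \<open>p\<^sub>j(x)\<close>; in the \<open>x\<close> direction it turns \<open>p\<^sub>j(i)\<close> into \<open>a\<^sub>i\<^sub>j\<close>
  (\<open>newton_form_interpolates\<close>).

  The formula is a linear combination of products of a Newton polynomial of degree \<open>< m\<close> in \<open>x\<close> and
  one of degree \<open>< n\<close> in \<open>y\<close>, so it is the evaluation of an element of the space
  (\<open>newton_form_in_poly_space\<close>). An element of the space is determined by its values on the grid: a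
  univariate polynomial with more roots than its degree vanishes, and this applies first in \<open>x\<close>, for each fixed \<open>j\<close>, and then in \<open>y\<close>, for each power of \<open>x\<close>
  (\<open>interpolates_unique\<close>). Hence the element found is the only interpolant, and every interpolant is
  given by the formula.
\<close>

section \<open>Newton's forward difference formula in one variable\<close>

text \<open>
  The difference at the node 1, in closed form rather than by iterating a difference operator, so
  that \<open>delta_a\<close> and \<open>delta_p\<close> are instances by definition.
\<close>

definition fwd_diff :: "(nat \<Rightarrow> real) \<Rightarrow> nat \<Rightarrow> real" where
  "fwd_diff f k = (\<Sum>\<beta>=0..k. (-1) ^ \<beta> * real (k choose \<beta>) * f (k + 1 - \<beta>))"

lemma delta_a_eq_fwd_diff: "delta_a A k r = fwd_diff (\<lambda>i. entry A i r) k"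
  by (simp add: delta_a_def fwd_diff_def)

lemma delta_p_eq_fwd_diff: "delta_p A m r x = fwd_diff (\<lambda>s. col_poly A m s x) r"
  by (simp add: delta_p_def fwd_diff_def)

lemma fwd_diff_0 [simp]: "fwd_diff f 0 = f 1"
  by (simp add: fwd_diff_def)

text \<open>
  Pascal's rule splits the alternating sum of order \<open>k + 1\<close> into two of order \<open>k\<close>, one of them for
  the shifted sequence. This recursion justifies the name of iterated difference.
\<close>

lemma fwd_diff_Suc: "fwd_diff f (Suc k) = fwd_diff (\<lambda>t. f (Suc t) - f t) k"
proof -
  let ?g = "\<lambda>b. (-1) ^ b * real (k choose b) * f (k + 2 - b)"
  let ?h = "\<lambda>b. (-1) ^ b * real (k choose b) * f (k + 1 - b)"
  have "fwd_diff f (Suc k) = f (k + 2) + (\<Sum>b\<le>k. ?g (Suc b) - ?h b)"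
    unfolding fwd_diff_def atLeast0AtMost sum.atMost_Suc_shift
    by (intro arg_cong2[where f = "(+)"] sum.cong refl) (simp_all add: algebra_simps)
  also have "\<dots> = (\<Sum>b\<le>Suc k. ?g b) - (\<Sum>b\<le>k. ?h b)"
    unfolding sum.atMost_Suc_shift by (simp add: sum_subtractf)
  also have "(\<Sum>b\<le>Suc k. ?g b) = (\<Sum>b\<le>k. ?g b)"
    by simp
  also have "(\<Sum>b\<le>k. ?g b) - (\<Sum>b\<le>k. ?h b) = (\<Sum>b\<le>k. ?g b - ?h b)"
    by (simp add: sum_subtractf)
  also have "\<dots> = fwd_diff (\<lambda>t. f (Suc t) - f t) k"
    unfolding fwd_diff_def atLeast0AtMost
    by (rule sum.cong) (simp_all add: algebra_simps Suc_diff_le)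
  finally show ?thesis .
qed

text \<open>
  By Pascal's rule, passing from \<open>j\<close> to \<open>j + 1\<close> adds to the sum for \<open>f\<close> the sum, up to \<open>j\<close>, for
  the difference sequence of \<open>f\<close>. The induction hypothesis for that sequence, which is why \<open>f\<close> must
  be arbitrary, evaluates the added part to \<open>f (j + 2) - f (j + 1)\<close>.
\<close>

lemma sum_choose_fwd_diff: "(\<Sum>k\<le>j. real (j choose k) * fwd_diff f k) = f (Suc j)"
proof (induction j arbitrary: f)
  case 0
  show ?case by simp
next
  case (Suc j)
  let ?D = "\<lambda>t. f (Suc t) - f t"
  have "(\<Sum>k\<le>Suc j. real (Suc j choose k) * fwd_diff f k)
      = fwd_diff f 0 + (\<Sum>k\<le>j. real (j choose Suc k) * fwd_diff f (Suc k))
        + (\<Sum>k\<le>j. real (j choose k) * fwd_diff ?D k)"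
    unfolding sum.atMost_Suc_shift
    by (simp add: fwd_diff_Suc algebra_simps sum.distrib)
  also have "fwd_diff f 0 + (\<Sum>k\<le>j. real (j choose Suc k) * fwd_diff f (Suc k))
      = (\<Sum>k\<le>Suc j. real (j choose k) * fwd_diff f k)"
    unfolding sum.atMost_Suc_shift by simp
  also have "\<dots> = (\<Sum>k\<le>j. real (j choose k) * fwd_diff f k)"
    by simp
  finally show ?case
    using Suc.IH[of f] Suc.IH[of ?D] by simp
qed

lemma newton_coeff_0 [simp]: "newton_coeff 0 x = 1"
  by (simp add: newton_coeff_def)

lemma newton_coeff_at_node: "newton_coeff k (real (Suc j)) = real (j choose k)"
  by (simp add: newton_coeff_def binomial_gbinomial gbinomial_prod_rev
      prod.atLeast1_atMost_eq atLeast0LessThan)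

lemma newton_forward_formula:
  assumes "j \<in> {1..n}"
  shows "(\<Sum>k<n. newton_coeff k (real j) * fwd_diff f k) = f j"
proof -
  obtain i where i: "j = Suc i" "i < n"
    using assms by (cases j) auto
  have "(\<Sum>k<n. newton_coeff k (real j) * fwd_diff f k)
      = (\<Sum>k<n. real (i choose k) * fwd_diff f k)"
    using i newton_coeff_at_node by simp
  \<comment> \<open>The basis polynomials of degree above \<open>i\<close> vanish at the node \<open>i + 1\<close>.\<close>
  also have "\<dots> = (\<Sum>k\<le>i. real (i choose k) * fwd_diff f k)"
    by (rule sum.mono_neutral_right) (use i in auto)
  finally show ?thesis
    using i by (simp add: sum_choose_fwd_diff)
qed

section \<open>The bivariate Newton form\<close>

definition newton_form :: "real mat \<Rightarrow> nat \<Rightarrow> nat \<Rightarrow> real \<Rightarrow> real \<Rightarrow> real" where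
  "newton_form A m n x y = (\<Sum>r<n. newton_coeff r y * delta_p A m r x)"

text \<open>
  Bridges the explicit formulas, which set apart the constant term and start at 1, and the uniform
  sums over \<open>{..<n}\<close>.
\<close>

lemma newton_sum_split:
  assumes "n > 0"
  shows "(\<Sum>k<n. newton_coeff k x * d k) = d 0 + (\<Sum>k=1..n-1. newton_coeff k x * d k)"
proof -
  have "{..<n} = insert 0 {1..n-1}"
    using assms by auto
  then show ?thesis by simp
qed

lemma col_poly_eq_newton_sum:
  assumes "m > 0"
  shows "col_poly A m r x = (\<Sum>k<m. newton_coeff k x * delta_a A k r)"
  unfolding newton_sum_split[OF assms] by (simp add: col_poly_def delta_a_def)

lemma newton_form_eq:
  assumes "n > 0"
  shows "newton_form A m n x y =
    col_poly A m 1 x + (\<Sum>r=1..n-1. newton_coeff r y * delta_p A m r x)"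
  unfolding newton_form_def newton_sum_split[OF assms] by (simp add: delta_p_def)

lemma newton_form_interpolates:
  assumes "m > 0" "i \<in> {1..m}" "j \<in> {1..n}"
  shows "newton_form A m n (real i) (real j) = entry A i j"
proof -
  have "newton_form A m n (real i) (real j) = col_poly A m j (real i)"
    unfolding newton_form_def delta_p_eq_fwd_diff
    by (rule newton_forward_formula[OF assms(3)])
  also have "\<dots> = entry A i j"
    unfolding col_poly_eq_newton_sum[OF assms(1)] delta_a_eq_fwd_diff
    by (rule newton_forward_formula[OF assms(2)])
  finally show ?thesis .
qed

section \<open>The space of bivariate polynomials\<close>

lemma eval2_sum_monom:
  "eval2 (\<Sum>k\<^sub>1<m. \<Sum>k\<^sub>2<n. monom (monom (c k\<^sub>1 k\<^sub>2) k\<^sub>1) k\<^sub>2) x y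
     = (\<Sum>k\<^sub>1<m. \<Sum>k\<^sub>2<n. c k\<^sub>1 k\<^sub>2 * x ^ k\<^sub>1 * y ^ k\<^sub>2)"
  by (simp add: eval2_def poly_sum poly_monom)

lemma newton_coeff_as_power_sum:
  obtains b :: "nat \<Rightarrow> nat \<Rightarrow> real"
  where "\<And>m k x. k < m \<Longrightarrow> newton_coeff k x = (\<Sum>i<m. b k i * x ^ i)"
proof
  fix m k :: nat and x :: real
  assume "k < m"
  let ?q = "\<lambda>k. smult (1 / fact k) (\<Prod>s=1..k. [:- real s, 1:])"
  have "degree (\<Prod>s=1..k. [:- real s, 1:]) \<le> k"
    using degree_prod_sum_le[of "{1..k}" "\<lambda>s. [:- real s, 1:]"] by simp
  then have deg: "degree (?q k) \<le> k"
    by simp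
  have "newton_coeff k x = poly (?q k) x"
    by (simp add: newton_coeff_def poly_prod)
  also have "\<dots> = (\<Sum>i\<le>degree (?q k). coeff (?q k) i * x ^ i)"
    by (rule poly_altdef)
  also have "\<dots> = (\<Sum>i<m. coeff (?q k) i * x ^ i)"
    by (rule sum.mono_neutral_left)
      (use deg \<open>k < m\<close> in \<open>auto simp del: coeff_smult degree_smult_eq intro: coeff_eq_0\<close>)
  finally show "newton_coeff k x = (\<Sum>i<m. (\<lambda>k. coeff (?q k)) k i * x ^ i)" .
qed

text \<open>
  Taking differences in \<open>y\<close> is linear and does not affect the Newton polynomials in \<open>x\<close>. So the
  coefficients of the Newton form in the tensor product basis are the mixed differences \<open>?d\<close> of the
  matrix, and expanding both factors in powers gives an element of the space.
\<close>

lemma newton_form_in_poly_space: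
  assumes "m > 0"
  obtains P where "P \<in> poly_space m n" "\<And>x y. eval2 P x y = newton_form A m n x y"
proof -
  obtain b :: "nat \<Rightarrow> nat \<Rightarrow> real"
    where b: "\<And>m k x. k < m \<Longrightarrow> newton_coeff k x = (\<Sum>i<m. b k i * x ^ i)"
    by (rule newton_coeff_as_power_sum) blast
  let ?d = "\<lambda>k r. fwd_diff (delta_a A k) r"
  let ?c = "\<lambda>k\<^sub>1 k\<^sub>2. \<Sum>r<n. \<Sum>k<m. ?d k r * b k k\<^sub>1 * b r k\<^sub>2"
  let ?P = "\<Sum>k\<^sub>1<m. \<Sum>k\<^sub>2<n. monom (monom (?c k\<^sub>1 k\<^sub>2) k\<^sub>1) k\<^sub>2"
  have diff: "delta_p A m r x = (\<Sum>k<m. newton_coeff k x * ?d k r)" for r x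
    unfolding delta_p_def col_poly_eq_newton_sum[OF assms] fwd_diff_def sum_distrib_left
    by (subst sum.swap) (simp add: mult_ac)
  have "eval2 ?P x y = newton_form A m n x y" for x y
  proof -
    have "eval2 ?P x y = (\<Sum>k\<^sub>1<m. \<Sum>k\<^sub>2<n. \<Sum>r<n. \<Sum>k<m.
        ?d k r * (b k k\<^sub>1 * x ^ k\<^sub>1) * (b r k\<^sub>2 * y ^ k\<^sub>2))"
      unfolding eval2_sum_monom sum_distrib_right by (simp add: mult_ac)
    also have "\<dots> = (\<Sum>k\<^sub>1<m. \<Sum>r<n. \<Sum>k\<^sub>2<n. \<Sum>k<m.
        ?d k r * (b k k\<^sub>1 * x ^ k\<^sub>1) * (b r k\<^sub>2 * y ^ k\<^sub>2))"
      by (intro sum.cong refl sum.swap)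
    also have "\<dots> = (\<Sum>r<n. \<Sum>k\<^sub>1<m. \<Sum>k\<^sub>2<n. \<Sum>k<m.
        ?d k r * (b k k\<^sub>1 * x ^ k\<^sub>1) * (b r k\<^sub>2 * y ^ k\<^sub>2))"
      by (rule sum.swap)
    also have "\<dots> = (\<Sum>r<n. \<Sum>k\<^sub>1<m. \<Sum>k<m. \<Sum>k\<^sub>2<n.
        ?d k r * (b k k\<^sub>1 * x ^ k\<^sub>1) * (b r k\<^sub>2 * y ^ k\<^sub>2))"
      by (intro sum.cong refl sum.swap)
    also have "\<dots> = (\<Sum>r<n. \<Sum>k<m. \<Sum>k\<^sub>1<m. \<Sum>k\<^sub>2<n.
        ?d k r * (b k k\<^sub>1 * x ^ k\<^sub>1) * (b r k\<^sub>2 * y ^ k\<^sub>2))"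
      by (intro sum.cong refl sum.swap)
    also have "\<dots> = (\<Sum>r<n. \<Sum>k<m. ?d k r * newton_coeff k x * newton_coeff r y)"
    proof (intro sum.cong refl)
      fix r k assume "r \<in> {..<n}" "k \<in> {..<m}"
      then have kx: "newton_coeff k x = (\<Sum>i<m. b k i * x ^ i)"
        and ry: "newton_coeff r y = (\<Sum>i<n. b r i * y ^ i)"
        by (auto intro!: b)
      show "(\<Sum>k\<^sub>1<m. \<Sum>k\<^sub>2<n. ?d k r * (b k k\<^sub>1 * x ^ k\<^sub>1) * (b r k\<^sub>2 * y ^ k\<^sub>2))
          = ?d k r * newton_coeff k x * newton_coeff r y"
        unfolding kx ry
        by (simp only: sum_distrib_left[symmetric] sum_distrib_right[symmetric])
    qed
    also have "\<dots> = newton_form A m n x y"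
      unfolding newton_form_def diff sum_distrib_left by (simp add: mult_ac)
    finally show ?thesis .
  qed
  moreover have "?P \<in> poly_space m n"
    unfolding poly_space_def by (intro CollectI exI[of _ ?c]) simp
  ultimately show thesis
    using that by blast
qed

lemma power_sum_zero_coeffs:
  fixes e :: "nat \<Rightarrow> real"
  assumes zero: "\<And>i. i \<in> {1..m} \<Longrightarrow> (\<Sum>k<m. e k * real i ^ k) = 0" and "k < m"
  shows "e k = 0"
proof -
  let ?p = "\<Sum>k<m. monom (e k) k"
  have coeff_p: "coeff ?p k = (if k < m then e k else 0)" for k
    by (simp add: coeff_sum)
  have "?p = 0"
  proof (rule ccontr)
    assume nz: "?p \<noteq> 0"
    have "real ` {1..m} \<subseteq> {x. poly ?p x = 0}"
      using zero by (auto simp: poly_sum poly_monom)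
    then have "card (real ` {1..m}) \<le> card {x. poly ?p x = 0}"
      using poly_roots_finite[OF nz] by (rule card_mono[rotated])
    also have "\<dots> \<le> degree ?p"
      using nz by (rule card_poly_roots_bound)
    also have "\<dots> \<le> m - 1"
      by (rule degree_le) (auto simp: coeff_p)
    finally show False
      using \<open>k < m\<close> by (simp add: card_image)
  qed
  with coeff_p[of k] \<open>k < m\<close> show ?thesis
    by simp
qed

lemma interpolates_unique:
  assumes P: "P \<in> poly_space m n" "interpolates m n A P"
    and Q: "Q \<in> poly_space m n" "interpolates m n A Q"
  shows "P = Q"
proof -
  obtain c where c: "P = (\<Sum>k\<^sub>1<m. \<Sum>k\<^sub>2<n. monom (monom (c k\<^sub>1 k\<^sub>2) k\<^sub>1) k\<^sub>2)"
    using P(1) unfolding poly_space_def by blast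
  obtain d where d: "Q = (\<Sum>k\<^sub>1<m. \<Sum>k\<^sub>2<n. monom (monom (d k\<^sub>1 k\<^sub>2) k\<^sub>1) k\<^sub>2)"
    using Q(1) unfolding poly_space_def by blast
  let ?e = "\<lambda>k\<^sub>1 k\<^sub>2. c k\<^sub>1 k\<^sub>2 - d k\<^sub>1 k\<^sub>2"
  have grid: "(\<Sum>k\<^sub>1<m. (\<Sum>k\<^sub>2<n. ?e k\<^sub>1 k\<^sub>2 * real j ^ k\<^sub>2) * real i ^ k\<^sub>1) = 0"
    if "i \<in> {1..m}" "j \<in> {1..n}" for i j
  proof -
    have "eval2 P (real i) (real j) = eval2 Q (real i) (real j)"
      using P(2) Q(2) that unfolding interpolates_def by metis
    moreover have "(\<Sum>k\<^sub>1<m. (\<Sum>k\<^sub>2<n. ?e k\<^sub>1 k\<^sub>2 * real j ^ k\<^sub>2) * real i ^ k\<^sub>1)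
        = eval2 P (real i) (real j) - eval2 Q (real i) (real j)"
      unfolding c d eval2_sum_monom sum_distrib_right sum_subtractf[symmetric]
      by (intro sum.cong refl) (simp add: algebra_simps)
    ultimately show ?thesis
      by simp
  qed
  have "?e k\<^sub>1 k\<^sub>2 = 0" if "k\<^sub>1 < m" "k\<^sub>2 < n" for k\<^sub>1 k\<^sub>2
  proof (rule power_sum_zero_coeffs[where m = n])
    fix j assume "j \<in> {1..n}"
    then show "(\<Sum>k\<^sub>2<n. ?e k\<^sub>1 k\<^sub>2 * real j ^ k\<^sub>2) = 0"
      by (intro power_sum_zero_coeffs[where m = m and k = k\<^sub>1
            and e = "\<lambda>k\<^sub>1. \<Sum>k\<^sub>2<n. ?e k\<^sub>1 k\<^sub>2 * real j ^ k\<^sub>2"] grid that(1))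
  qed (rule that(2))
  then show ?thesis
    unfolding c d by (intro sum.cong refl) simp
qed

section \<open>Existence, uniqueness and the explicit formula\<close>

theorem theorem3p3:
  fixes m n :: nat and A :: "real mat"
  assumes "m > 0" and "n > 0" and "A \<in> carrier_mat m n"
  shows "(\<exists>!P. P \<in> poly_space m n \<and> interpolates m n A P) \<and>
    (\<forall>P. P \<in> poly_space m n \<and> interpolates m n A P \<longrightarrow>
      (\<forall>x y. eval2 P x y =
         col_poly A m 1 x + (\<Sum>r=1..n-1. newton_coeff r y * delta_p A m r x)))"
proof -
  obtain P where P: "P \<in> poly_space m n" and eval_P: "\<And>x y. eval2 P x y = newton_form A m n x y"
    by (rule newton_form_in_poly_space[OF assms(1)]) blast
  have int_P: "interpolates m n A P"
    unfolding interpolates_def eval_P using newton_form_interpolates[OF assms(1)] by simp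
  have uniq: "Q = P" if "Q \<in> poly_space m n \<and> interpolates m n A Q" for Q
    using that P int_P interpolates_unique by blast
  show ?thesis
  proof (intro conjI allI impI)
    show "\<exists>!P. P \<in> poly_space m n \<and> interpolates m n A P"
      using P int_P uniq by blast
  next
    fix Q x y
    assume "Q \<in> poly_space m n \<and> interpolates m n A Q"
    then have "Q = P" by (rule uniq)
    then show "eval2 Q x y =
        col_poly A m 1 x + (\<Sum>r=1..n-1. newton_coeff r y * delta_p A m r x)"
      using eval_P newton_form_eq[OF assms(2)] by simp
  qed
qed

end
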